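(* For every integer $n\ge 1$, $$\mathrm{CQ}_n\cong\mathrm{DT}_n\cong\mathrm{RT}_n\cong\mathcal{M}_{2n},$$ where $\cong$ means that there is a bijection between the two sets.
   Context: - $\mathrm{CQ}_n$ is the set of Stirling permutation codes of length $n$: sequences of pairs of integers $((0,0),(a_1,b_1),(a_2,b_2),\ldots,(a_{n-1},b_{n-1}))$ such that $1\le a_i\le i$ and $1\le b_i\le 3$ for all $1\le i\le n-1$, and $(a_i,b_i)\ne(a_j,b_j)$ for all $1\le i<j\le n-1$. (In particular $\mathrm{CQ}_1=\{((0,0))\}$.) - $\mathrm{DT}_n$ is the set of Dumont trapezoidal words of length $n$: words $w_1w_2\cdots w_n$ of integers with $0\le|w_i|<i$ for all $i$. - $\mathrm{RT}_n$ is the set of Riordan trapezoidal words of length $n$: words $t_1t_2\cdots t_n$ with $t_i\in\{1,2,\ldots,2i-1\}$ for all $i$. - $\mathcal{M}_{2n}$ is the set of perfect matchings of $[2n]=\{1,\ldots,2n\}$, i.e. set partitions of $[2n]$ all of whose blocks have size exactly $2$. *)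

theory Defs
  imports "HOL-Library.Disjoint_Sets" "HOL-Library.Equipollence"
begin

text \<open>A sequence or word of length \<open>n\<close> is a list of length \<open>n\<close>. The entries of a code are indexed
  from \<open>0\<close>, so \<open>(a\<^sub>i, b\<^sub>i)\<close> is \<open>c ! i\<close>; the letters of a word are indexed from \<open>1\<close>, so \<open>w\<^sub>i\<close> is
  \<open>w ! (i - 1)\<close>. The definition of \<open>stirling_codes\<close> is meaningful only for \<open>n \<ge> 1\<close>.\<close>

definition stirling_codes :: "nat \<Rightarrow> (int \<times> int) list set" where
  "stirling_codes n =
    {c. length c = n \<and> c ! 0 = (0, 0) \<and>
        (\<forall>i\<in>{1..n - 1}. 1 \<le> fst (c ! i) \<and> fst (c ! i) \<le> int i \<and>
                         1 \<le> snd (c ! i) \<and> snd (c ! i) \<le> 3) \<and>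
        (\<forall>i j. 1 \<le> i \<and> i < j \<and> j \<le> n - 1 \<longrightarrow> c ! i \<noteq> c ! j)}"

definition dumont_words :: "nat \<Rightarrow> int list set" where
  "dumont_words n =
    {w. length w = n \<and> (\<forall>i\<in>{1..n}. 0 \<le> \<bar>w ! (i - 1)\<bar> \<and> \<bar>w ! (i - 1)\<bar> < int i)}"

definition riordan_words :: "nat \<Rightarrow> nat list set" where
  "riordan_words n = {t. length t = n \<and> (\<forall>i\<in>{1..n}. t ! (i - 1) \<in> {1..2 * i - 1})}"

definition perfect_matchings :: "nat \<Rightarrow> nat set set set" where
  "perfect_matchings m = {P. partition_on {1..m} P \<and> (\<forall>B\<in>P. card B = 2)}"

end

theory Submission
  imports Defs
begin

text \<open>
  All four families are finite and have \<open>1 \<cdot> 3 \<cdot> 5 \<cdots> (2n - 1)\<close> members, so they are equinumerous.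
  In each family the member is determined by \<open>n\<close> successive choices, and the number of options at each
  of them does not depend on the choices already made.

  For the three families of words a step appends a letter (\<open>card_append_letter\<close>). The letter
  appended to a trapezoidal word of length \<open>k\<close> comes from \<open>{-k..k}\<close> or \<open>{1..2k + 1}\<close>. The pair
  appended to a Stirling code of length \<open>k \<ge> 1\<close> is one of the \<open>3k\<close> pairs in \<open>{1..k} \<times> {1..3}\<close>, but not
  one of the \<open>k - 1\<close> distinct pairs already present; all of these lie in that rectangle, so
  \<open>3k - (k - 1) = 2k + 1\<close> pairs remain. The first entry is forced, which is the factor \<open>1\<close>.

  For a matching of \<open>2k + 2\<close> points a step chooses the partner of one fixed point among the \<open>2k + 1\<close>
  others and leaves a matching of the remaining \<open>2k\<close> points (\<open>card_matchings\<close>). These remaining points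
  need not form an interval \<open>{1..2k}\<close>, which is why matchings are counted on an arbitrary finite set.
\<close>

section \<open>Words built letter by letter\<close>

text \<open>The set \<open>C xs\<close> of admissible next letters may depend on the prefix, as it does for Stirling
  codes; only its size has to be constant.\<close>

lemma card_append_letter:
  assumes "finite S" "[] \<notin> T"
    and letters: "\<And>xs. xs \<in> S \<Longrightarrow> finite (C xs) \<and> card (C xs) = k"
    and snoc: "\<And>xs x. xs @ [x] \<in> T \<longleftrightarrow> xs \<in> S \<and> x \<in> C xs"
  shows "finite T \<and> card T = card S * k"
proof -
  have T: "T = (\<lambda>(xs, x). xs @ [x]) ` Sigma S C"
  proof (intro set_eqI iffI)
    fix t assume "t \<in> T"
    then obtain xs x where "t = xs @ [x]"
      using \<open>[] \<notin> T\<close> by (cases t rule: rev_cases) auto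
    with \<open>t \<in> T\<close> show "t \<in> (\<lambda>(xs, x). xs @ [x]) ` Sigma S C"
      using snoc by force
  qed (use snoc in auto)
  have "inj_on (\<lambda>(xs, x). xs @ [x]) (Sigma S C)"
    by (auto simp: inj_on_def)
  then have "card T = card (Sigma S C)"
    unfolding T by (rule card_image)
  also have "\<dots> = (\<Sum>xs\<in>S. card (C xs))"
    using assms(1) letters by (intro card_SigmaI) auto
  also have "\<dots> = card S * k"
    using letters by simp
  finally show ?thesis
    unfolding T using assms(1) letters by auto
qed

lemma card_dumont_words:
  "finite (dumont_words n) \<and> card (dumont_words n) = (\<Prod>i<n. 2 * i + 1)"
proof (induction n)
  case 0
  have "dumont_words 0 = {[]}"
    by (auto simp: dumont_words_def)
  then show ?case by simp
next
  case (Suc n)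
  have "finite (dumont_words (Suc n)) \<and>
        card (dumont_words (Suc n)) = card (dumont_words n) * (2 * n + 1)"
  proof (rule card_append_letter)
    fix xs :: "int list" and x
    show "xs @ [x] \<in> dumont_words (Suc n) \<longleftrightarrow> xs \<in> dumont_words n \<and> x \<in> {- int n..int n}"
      by (auto simp: dumont_words_def atLeastAtMostSuc_conv nth_append)
  qed (use Suc in \<open>auto simp: dumont_words_def\<close>)
  with Suc show ?case by simp
qed

lemma card_riordan_words:
  "finite (riordan_words n) \<and> card (riordan_words n) = (\<Prod>i<n. 2 * i + 1)"
proof (induction n)
  case 0
  have "riordan_words 0 = {[]}"
    by (auto simp: riordan_words_def)
  then show ?case by simp
next
  case (Suc n)
  have "finite (riordan_words (Suc n)) \<and>
        card (riordan_words (Suc n)) = card (riordan_words n) * (2 * n + 1)"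
  proof (rule card_append_letter)
    fix xs :: "nat list" and x
    show "xs @ [x] \<in> riordan_words (Suc n) \<longleftrightarrow> xs \<in> riordan_words n \<and> x \<in> {1..2 * n + 1}"
      by (auto simp: riordan_words_def atLeastAtMostSuc_conv nth_append)
  qed (use Suc in \<open>auto simp: riordan_words_def\<close>)
  with Suc show ?case by simp
qed

section \<open>Stirling permutation codes\<close>

text \<open>The initial entry \<open>(0, 0)\<close> lies outside every rectangle \<open>{1..n} \<times> {1..3}\<close> and is exempt from
  the distinctness condition, so only the entries with index from \<open>1\<close> on are excluded.\<close>

lemma stirling_codes_snoc:
  assumes "n \<ge> 1"
  shows "c @ [p] \<in> stirling_codes (Suc n) \<longleftrightarrow>
         c \<in> stirling_codes n \<and> p \<in> ({1..int n} \<times> {1..3}) - (!) c ` {1..<n}"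
    (is "?L \<longleftrightarrow> ?R")
proof (cases "length c = n")
  case len: True
  have old: "(c @ [p]) ! i = c ! i" if "i < n" for i
    using that len by (simp add: nth_append)
  have new: "(c @ [p]) ! n = p"
    using len by (simp add: nth_append)
  have idx: "{1..Suc n - 1} = insert n {1..n - 1}"
    using assms by auto
  have range: "(\<forall>i\<in>{1..Suc n - 1}. 1 \<le> fst ((c @ [p]) ! i) \<and> fst ((c @ [p]) ! i) \<le> int i \<and>
                  1 \<le> snd ((c @ [p]) ! i) \<and> snd ((c @ [p]) ! i) \<le> 3) \<longleftrightarrow>
               (\<forall>i\<in>{1..n - 1}. 1 \<le> fst (c ! i) \<and> fst (c ! i) \<le> int i \<and>
                  1 \<le> snd (c ! i) \<and> snd (c ! i) \<le> 3) \<and> p \<in> {1..int n} \<times> {1..3}"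
    unfolding idx using old new by (cases p) auto
  have distinct: "(\<forall>i j. 1 \<le> i \<and> i < j \<and> j \<le> Suc n - 1 \<longrightarrow> (c @ [p]) ! i \<noteq> (c @ [p]) ! j) \<longleftrightarrow>
               (\<forall>i j. 1 \<le> i \<and> i < j \<and> j \<le> n - 1 \<longrightarrow> c ! i \<noteq> c ! j) \<and> p \<notin> (!) c ` {1..<n}"
    (is "?D \<longleftrightarrow> ?D' \<and> ?N")
  proof
    assume D: ?D
    have ?D'
    proof (intro allI impI)
      fix i j assume ij: "1 \<le> i \<and> i < j \<and> j \<le> n - 1"
      then have "(c @ [p]) ! i \<noteq> (c @ [p]) ! j" using D by auto
      then show "c ! i \<noteq> c ! j" using ij old assms by auto
    qed
    moreover have "c ! i \<noteq> p" if "i \<in> {1..<n}" for i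
    proof -
      have "(c @ [p]) ! i \<noteq> (c @ [p]) ! n" using D that by auto
      then show ?thesis using that old new by simp
    qed
    ultimately show "?D' \<and> ?N" by blast
  next
    assume R: "?D' \<and> ?N"
    show ?D
    proof (intro allI impI)
      fix i j assume ij: "1 \<le> i \<and> i < j \<and> j \<le> Suc n - 1"
      show "(c @ [p]) ! i \<noteq> (c @ [p]) ! j"
      proof (cases "j = n")
        case True
        then show ?thesis using R ij old new by force
      next
        case False
        then have "j \<le> n - 1" "i < n" "j < n" using ij by auto
        then show ?thesis using R ij old by simp
      qed
    qed
  qed
  show ?thesis
    unfolding stirling_codes_def mem_Collect_eq range distinct using len old assms by auto
qed (auto simp: stirling_codes_def)

lemma card_free_pairs:
  assumes "n \<ge> 1" and c: "c \<in> stirling_codes n"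
  shows "card (({1..int n} \<times> {1..3}) - (!) c ` {1..<n}) = 2 * n + 1"
proof -
  have "inj_on ((!) c) {1..<n}"
  proof (rule linorder_inj_onI)
    fix i j assume "i < j" "i \<in> {1..<n}" "j \<in> {1..<n}"
    then show "c ! i \<noteq> c ! j" using c by (auto simp: stirling_codes_def)
  qed auto
  then have used: "card ((!) c ` {1..<n}) = n - 1"
    by (simp add: card_image)
  have "(!) c ` {1..<n} \<subseteq> {1..int n} \<times> {1..3}"
  proof
    fix q assume "q \<in> (!) c ` {1..<n}"
    then obtain i where i: "i \<in> {1..<n}" "q = c ! i" by blast
    then have "1 \<le> fst q \<and> fst q \<le> int i \<and> 1 \<le> snd q \<and> snd q \<le> 3"
      using c by (auto simp: stirling_codes_def)
    then show "q \<in> {1..int n} \<times> {1..3}"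
      using i by (simp add: mem_Times_iff)
  qed
  then have "card (({1..int n} \<times> {1..3}) - (!) c ` {1..<n}) = 3 * n - (n - 1)"
    using used by (subst card_Diff_subset) (auto simp: card_cartesian_product)
  then show ?thesis using assms(1) by simp
qed

lemma card_stirling_codes:
  assumes "n \<ge> 1"
  shows "finite (stirling_codes n) \<and> card (stirling_codes n) = (\<Prod>i<n. 2 * i + 1)"
  using assms
proof (induction n rule: nat_induct_at_least)
  case base
  have "stirling_codes 1 = {[(0, 0)]}"
    by (auto simp: stirling_codes_def length_Suc_conv)
  then show ?case by simp
next
  case (Suc n)
  have "finite (stirling_codes (Suc n)) \<and>
        card (stirling_codes (Suc n)) = card (stirling_codes n) * (2 * n + 1)"
    by (rule card_append_letter[OF _ _ _ stirling_codes_snoc[OF Suc.hyps]])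
      (use Suc card_free_pairs in \<open>auto simp: stirling_codes_def\<close>)
  with Suc show ?case by simp
qed

section \<open>Perfect matchings\<close>

definition matchings :: "'a set \<Rightarrow> 'a set set set" where
  "matchings V = {P. partition_on V P \<and> (\<forall>B\<in>P. card B = 2)}"

lemma matchings_insert_edge:
  assumes "P \<in> matchings (V - {a, b})" "a \<in> V" "b \<in> V" "a \<noteq> b"
  shows "insert {a, b} P \<in> matchings V"
proof -
  have "partition_on V (insert {a, b} P)"
    using assms partition_onD1[of "V - {a, b}" P]
    by (intro partition_on_insert[THEN iffD2])
      (auto simp: matchings_def disjnt_def)
  then show ?thesis using assms by (auto simp: matchings_def)
qed

lemma matchings_remove_edge:
  assumes "P \<in> matchings V" "{a, b} \<in> P"
  shows "P - {{a, b}} \<in> matchings (V - {a, b})"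
proof -
  have P: "partition_on V P" using assms by (simp add: matchings_def)
  have "insert {a, b} (P - {{a, b}}) = P" using assms by blast
  moreover have "disjnt {a, b} (\<Union>(P - {{a, b}}))"
    using P assms(2) by (fastforce simp: disjnt_def partition_on_def disjoint_def)
  ultimately have "partition_on (V - {a, b}) (P - {{a, b}})"
    using P partition_on_insert by metis
  then show ?thesis using assms by (auto simp: matchings_def)
qed

lemma matching_partner:
  assumes "P \<in> matchings V" "a \<in> V"
  obtains b where "b \<in> V - {a}" "{a, b} \<in> P"
proof -
  have P: "\<Union>P = V" using assms by (auto simp: matchings_def partition_on_def)
  then obtain B where B: "B \<in> P" "a \<in> B" using assms by blast
  then have "card B = 2" using assms by (auto simp: matchings_def)
  then obtain b where "B = {a, b}" "b \<noteq> a"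
    using B(2) by (auto simp: card_2_iff)
  then show ?thesis using that P B by blast
qed

text \<open>A matching of the rest has no edge at \<open>a\<close>. Hence adding \<open>{a, b}\<close> is injective, and matchings
  obtained with different partners \<open>b\<close> of \<open>a\<close> are different.\<close>

lemma edge_notin_matching_of_rest:
  "P \<in> matchings (V - {a, b}) \<Longrightarrow> {a, c} \<notin> P"
  by (auto simp: matchings_def partition_on_def)

lemma matchings_by_partner:
  assumes "a \<in> V"
  shows "matchings V = (\<Union>b\<in>V - {a}. insert {a, b} ` matchings (V - {a, b}))"
proof (intro set_eqI iffI)
  fix P assume P: "P \<in> matchings V"
  then obtain b where b: "b \<in> V - {a}" "{a, b} \<in> P"
    using assms by (rule matching_partner)
  then have "P = insert {a, b} (P - {{a, b}})" by blast
  then show "P \<in> (\<Union>b\<in>V - {a}. insert {a, b} ` matchings (V - {a, b}))"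
    using b matchings_remove_edge[OF P b(2)] by blast
next
  fix P assume "P \<in> (\<Union>b\<in>V - {a}. insert {a, b} ` matchings (V - {a, b}))"
  then obtain b Q where "b \<in> V - {a}" "Q \<in> matchings (V - {a, b})" "P = insert {a, b} Q"
    by blast
  then show "P \<in> matchings V"
    using assms matchings_insert_edge[of Q V a b] by auto
qed

lemma card_matchings:
  assumes "finite V" "card V = 2 * n"
  shows "finite (matchings V) \<and> card (matchings V) = (\<Prod>i<n. 2 * i + 1)"
  using assms
proof (induction n arbitrary: V)
  case 0
  then have "matchings V = {{}}"
    by (auto simp: matchings_def partition_on_def)
  then show ?case by simp
next
  case (Suc n)
  then obtain a where a: "a \<in> V" by fastforce
  let ?M = "\<lambda>b. matchings (V - {a, b})"
  let ?F = "\<lambda>b. insert {a, b} ` ?M b"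
  have rest: "finite (?M b) \<and> card (?M b) = (\<Prod>i<n. 2 * i + 1)" if "b \<in> V - {a}" for b
  proof (rule Suc.IH)
    show "card (V - {a, b}) = 2 * n"
      using Suc.prems a that by (subst card_Diff_subset) auto
  qed (use Suc.prems in simp)
  have inj: "inj_on (insert {a, b}) (?M b)" for b
  proof (rule inj_onI)
    fix P Q assume "P \<in> ?M b" "Q \<in> ?M b" "insert {a, b} P = insert {a, b} Q"
    then show "P = Q"
      using insert_ident[of "{a, b}" P Q] by (simp add: edge_notin_matching_of_rest)
  qed
  have disj: "?F b \<inter> ?F b' = {}" if "b \<noteq> b'" for b b'
  proof (rule equals0I)
    fix P assume P: "P \<in> ?F b \<inter> ?F b'"
    then obtain Q where Q: "P = insert {a, b} Q" "Q \<in> ?M b" by auto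
    from P obtain Q' where "P = insert {a, b'} Q'" by auto
    then have "{a, b'} \<in> P" by simp
    then have "{a, b'} \<in> insert {a, b} Q" by (simp only: Q(1))
    then have "{a, b'} = {a, b}" using edge_notin_matching_of_rest[OF Q(2)] by simp
    then show False using that by (simp add: doubleton_eq_iff)
  qed
  have "card (matchings V) = (\<Sum>b\<in>V - {a}. card (?F b))"
    unfolding matchings_by_partner[OF a]
    by (rule card_UN_disjoint) (use Suc.prems rest disj in auto)
  also have "\<dots> = (\<Sum>b\<in>V - {a}. \<Prod>i<n. 2 * i + 1)"
    using rest by (intro sum.cong) (auto simp: card_image[OF inj])
  also have "\<dots> = (2 * n + 1) * (\<Prod>i<n. 2 * i + 1)"
    using Suc.prems a by simp
  finally have "card (matchings V) = (\<Prod>i<Suc n. 2 * i + 1)" by simp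
  moreover have "finite (matchings V)"
    unfolding matchings_by_partner[OF a] using Suc.prems rest by auto
  ultimately show ?case by blast
qed

lemma card_perfect_matchings:
  "finite (perfect_matchings (2 * n)) \<and> card (perfect_matchings (2 * n)) = (\<Prod>i<n. 2 * i + 1)"
  using card_matchings[of "{1..2 * n}" n]
  by (simp add: matchings_def perfect_matchings_def)

theorem theorem19:
  fixes n :: nat
  assumes "n \<ge> 1"
  shows "stirling_codes n \<approx> dumont_words n \<and>
         dumont_words n \<approx> riordan_words n \<and>
         riordan_words n \<approx> perfect_matchings (2 * n)"
  using card_stirling_codes[OF assms] card_dumont_words[of n] card_riordan_words[of n]
    card_perfect_matchings[of n]
  by (simp add: eqpoll_iff_card)

end
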